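(* Algorithm $\textsc{Move-Half}$ is $4$ access-competitive with respect to an MRU algorithm: for every request sequence $\sigma$, the total access cost of $\textsc{Move-Half}$ on $\sigma$ is at most $4$ times the total access cost of an algorithm maintaining an MRU tree on $\sigma$.
   Context: Self-adjusting complete tree model: a set $V$ of $n$ items is stored in a complete binary tree of $n$ servers, one item per server; the root has depth $0$ and an item's depth is that of its hosting server. Requests $\sigma=(\sigma^{(1)},\sigma^{(2)},\dots)$ are revealed online; serving a request to an item at depth $d$ incurs access cost $d$; a swap exchanges the items of a server and its parent. The rank of item $v$ at time $t$ is the number of distinct items requested since the last request of $v$ before $t$, including $v$. An MRU tree at time $t$ is one in which every item $v$ has depth $\lfloor \log_2 v.\mathrm{rank}\rfloor$; an MRU algorithm maintains an MRU tree at all times, so the access cost of a request to an item of rank $r$ is $\lfloor\log_2 r\rfloor$. Algorithm $\textsc{Move-Half}$: it starts from an MRU tree. Upon a request to item $u$ at depth $d$, it accesses $u$, lets $v$ be the item of highest rank among the items at depth $\lfloor d/2\rfloor$, and interchanges $u$ and $v$ (swapping $u$ along the tree path to $v$'s server, then $v$ back along the same path to $u$'s former server, so that only $u$ and $v$ change positions). *)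

theory Defs
  imports Complex_Main
begin

text \<open>
  Servers carry heap indices: the complete binary tree with \<open>n\<close> servers has server set
  \<open>{1..n}\<close>, root \<open>1\<close>, and the parent of \<open>i > 1\<close> is \<open>i div 2\<close>. No restriction to
  \<open>n = 2 ^ k - 1\<close> is made; the last level may be partially filled.
\<close>

fun server_depth :: "nat \<Rightarrow> nat" where
  "server_depth i = (if i \<le> 1 then 0 else Suc (server_depth (i div 2)))"

declare server_depth.simps [simp del]

type_synonym 'a placement = "'a \<Rightarrow> nat"

definition is_placement :: "'a set \<Rightarrow> 'a placement \<Rightarrow> bool" where
  "is_placement V T \<longleftrightarrow> bij_betw T V {1..card V}"

definition item_depth :: "'a placement \<Rightarrow> 'a \<Rightarrow> nat" where
  "item_depth T v = server_depth (T v)"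

text \<open>
  A history \<open>H\<close> lists all past requests, oldest first. The rank is meaningful only for
  \<open>v \<in> set H\<close>: then the \<open>takeWhile\<close> prefix of the reversed history consists of the
  requests strictly after the last request of \<open>v\<close>. To give every item a rank from the very
  beginning, runs start from a history \<open>h\<close> with \<open>set h = V\<close>; listing the items in an
  arbitrary order realises an arbitrary initial ranking.
\<close>

definition rank :: "'a list \<Rightarrow> 'a \<Rightarrow> nat" where
  "rank H v = card (insert v (set (takeWhile (\<lambda>x. x \<noteq> v) (rev H))))"

definition mru_tree :: "'a set \<Rightarrow> 'a list \<Rightarrow> 'a placement \<Rightarrow> bool" where
  "mru_tree V H T \<longleftrightarrow>
     is_placement V T \<and> (\<forall>v\<in>V. int (item_depth T v) = \<lfloor>log 2 (real (rank H v))\<rfloor>)"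

text \<open>
  An algorithm maps the list of requests served so far to the current placement, so the
  request \<open>\<sigma> ! t\<close> is accessed in the placement reached after \<open>take t \<sigma>\<close>.
\<close>

definition access_cost :: "('a list \<Rightarrow> 'a placement) \<Rightarrow> 'a list \<Rightarrow> nat" where
  "access_cost A \<sigma> = (\<Sum>t<length \<sigma>. item_depth (A (take t \<sigma>)) (\<sigma> ! t))"

definition mru_algorithm :: "'a set \<Rightarrow> 'a list \<Rightarrow> ('a list \<Rightarrow> 'a placement) \<Rightarrow> bool" where
  "mru_algorithm V h A \<longleftrightarrow> (\<forall>\<sigma>. set \<sigma> \<subseteq> V \<longrightarrow> mru_tree V (h @ \<sigma>) (A \<sigma>))"

definition highest_rank_item :: "'a set \<Rightarrow> 'a list \<Rightarrow> 'a placement \<Rightarrow> nat \<Rightarrow> 'a" where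
  "highest_rank_item V H T k = (ARG_MAX (rank H) v. v \<in> V \<and> item_depth T v = k)"

text \<open>
  Moving \<open>u\<close> by parent-child swaps along the tree path to the server of \<open>v\<close>, and then \<open>v\<close>
  back along that path, restores all intermediate items; the net effect is the exchange below.
\<close>

definition move_half_step :: "'a set \<Rightarrow> 'a list \<Rightarrow> 'a placement \<Rightarrow> 'a \<Rightarrow> 'a placement" where
  "move_half_step V H T u =
     (let v = highest_rank_item V H T (item_depth T u div 2) in T(u := T v, v := T u))"

fun move_half :: "'a set \<Rightarrow> 'a list \<Rightarrow> 'a placement \<Rightarrow> 'a list \<Rightarrow> 'a placement" where
  "move_half V H T [] = T"
| "move_half V H T (u # \<sigma>) = move_half V (H @ [u]) (move_half_step V H T u) \<sigma>"

end

theory Submission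
  imports Defs "HOL-Combinatorics.Transposition"
begin

text \<open>
  Let \<open>g d = d + d div 2 + d div 4 + \<dots>\<close> be the cost of requesting an item at depth \<open>d\<close> over and
  over again. The sum over all items of the truncated difference of \<open>g\<close> of the actual depth and
  4 times the MRU depth is a potential that vanishes initially. A request to \<open>u\<close> at depth \<open>d\<close>
  costs \<open>d = g d - g (d div 2)\<close>, which is paid for by the change of the contribution of \<open>u\<close> and
  4 times its MRU depth. The item \<open>v\<close> that is pushed down from depth \<open>k = d div 2\<close> contributes
  nothing afterwards: level \<open>k\<close> is full, so \<open>v\<close> had the highest rank of \<open>2 ^ k\<close> items, and after
  the request to \<open>u\<close> its rank exceeds \<open>2 ^ k\<close>. All other items only gain rank.
\<close>

subsection \<open>Depths of servers\<close>

lemma server_depth_bounds: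
  "i \<ge> 1 \<Longrightarrow> 2 ^ server_depth i \<le> i \<and> i < 2 ^ Suc (server_depth i)"
proof (induction i rule: server_depth.induct)
  case (1 i)
  show ?case
  proof (cases "i \<le> 1")
    case True
    with 1 show ?thesis by (simp add: server_depth.simps)
  next
    case False
    then have "2 ^ server_depth (i div 2) \<le> i div 2"
      and "i div 2 < 2 ^ Suc (server_depth (i div 2))"
      using 1 by auto
    then show ?thesis
      using False by (subst (1 2) server_depth.simps) auto
  qed
qed

lemma server_depth_eqI:
  assumes "2 ^ k \<le> i" and "i < 2 ^ Suc k"
  shows "server_depth i = k"
proof -
  have "1 \<le> i"
    using assms(1) by (metis one_le_numeral one_le_power order_trans)
  then have "(2::nat) ^ server_depth i < 2 ^ Suc k" "(2::nat) ^ k < 2 ^ Suc (server_depth i)"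
    using server_depth_bounds[of i] assms by linarith+
  then have "server_depth i < Suc k" "k < Suc (server_depth i)"
    by (auto intro: power_less_imp_less_exp[of "2::nat"] simp del: power_Suc)
  then show ?thesis
    by simp
qed

text \<open>An item below depth \<open>k\<close> sits at an index of at least
  \<open>2 ^ Suc k\<close>, so all indices from \<open>2 ^ k\<close> up to
  \<open>2 ^ Suc k - 1\<close> are occupied. Only the last level can be partial, and
  \<open>k\<close> lies above it.\<close>

lemma card_full_level:
  assumes "finite V" and "is_placement V T" and "u \<in> V" and "k < item_depth T u"
  shows "2 ^ k \<le> card {w \<in> V. item_depth T w = k}"
proof -
  have bij: "bij_betw T V {1..card V}"
    using assms(2) by (simp add: is_placement_def)
  then have Tu: "T u \<in> {1..card V}"
    using assms(3) by (auto simp: bij_betw_def)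
  have "(2::nat) ^ Suc k \<le> 2 ^ item_depth T u"
    using assms(4) by (intro power_increasing) auto
  also have "\<dots> \<le> card V"
    using server_depth_bounds[of "T u"] Tu by (auto simp: item_depth_def)
  finally have le: "2 ^ Suc k \<le> card V" .
  have "{2 ^ k..<2 ^ Suc k} \<subseteq> T ` {w \<in> V. item_depth T w = k}"
  proof
    fix i :: nat
    assume i: "i \<in> {2 ^ k..<2 ^ Suc k}"
    moreover have "(1::nat) \<le> 2 ^ k"
      by simp
    ultimately have "1 \<le> i" "i \<le> card V"
      using le unfolding atLeastLessThan_iff by linarith+
    then obtain w where "w \<in> V" "T w = i"
      using bij by (metis atLeastAtMost_iff bij_betw_def imageE)
    moreover from this have "item_depth T w = k"
      using i by (auto simp: item_depth_def intro!: server_depth_eqI)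
    ultimately show "i \<in> T ` {w \<in> V. item_depth T w = k}"
      by auto
  qed
  then have "card {2 ^ k..<2 ^ Suc k :: nat} \<le> card {w \<in> V. item_depth T w = k}"
    using assms(1) by (intro surj_card_le) auto
  then show ?thesis
    by simp
qed

subsection \<open>Ranks\<close>

text \<open>Comparing these sets by inclusion replaces counting: every comparison of ranks below
  comes from an inclusion.\<close>

definition recent :: "'a list \<Rightarrow> 'a \<Rightarrow> 'a set" where
  "recent H v = insert v (set (takeWhile (\<lambda>x. x \<noteq> v) (rev H)))"

lemma finite_recent [simp]: "finite (recent H v)"
  by (simp add: recent_def)

lemma rank_eq_card_recent: "rank H v = card (recent H v)"
  by (simp add: rank_def recent_def)

lemma rank_pos: "0 < rank H v"
  by (simp add: rank_def card_gt_0_iff)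

lemma rank_le: "rank H v \<le> Suc (length H)"
proof -
  have "rank H v \<le> Suc (card (set (takeWhile (\<lambda>x. x \<noteq> v) (rev H))))"
    unfolding rank_def by (rule card_insert_le_m1) auto
  also have "\<dots> \<le> Suc (length (takeWhile (\<lambda>x. x \<noteq> v) (rev H)))"
    by (simp only: Suc_le_mono card_length)
  also have "\<dots> \<le> Suc (length H)"
    using length_takeWhile_le[of _ "rev H"] by simp
  finally show ?thesis .
qed

lemma recent_snoc: "v \<noteq> u \<Longrightarrow> recent (H @ [u]) v = insert u (recent H v)"
  by (auto simp: recent_def)

lemma rank_le_rank_snoc: "v \<noteq> u \<Longrightarrow> rank H v \<le> rank (H @ [u]) v"
  unfolding rank_eq_card_recent by (rule card_mono) (auto simp: recent_snoc)

text \<open>\<open>v\<close> is met before any \<open>w\<close>, so the prefix stopping at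
  \<open>w\<close> runs past the first \<open>v\<close>; if \<open>w\<close> is absent, it is all of
  \<open>L\<close>.\<close>

lemma takeWhile_subset_takeWhile:
  "v \<in> set L \<Longrightarrow> w \<noteq> v \<Longrightarrow> w \<notin> set (takeWhile (\<lambda>x. x \<noteq> v) L) \<Longrightarrow>
    insert v (set (takeWhile (\<lambda>x. x \<noteq> v) L)) \<subseteq> set (takeWhile (\<lambda>x. x \<noteq> w) L)"
  by (induction L) (auto split: if_splits)

text \<open>If \<open>w\<close> was not requested since the last request of \<open>v\<close>, the
  window of \<open>w\<close> contains that of \<open>v\<close> and also \<open>w\<close> itself, so
  \<open>w\<close> would have the larger rank.\<close>

lemma in_recent_if_rank_le:
  assumes "v \<in> set H" and "rank H w \<le> rank H v"
  shows "w \<in> recent H v"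
proof (rule ccontr)
  assume w: "w \<notin> recent H v"
  then have "recent H v \<subseteq> recent H w"
    using takeWhile_subset_takeWhile[of v "rev H" w] assms(1) by (auto simp: recent_def)
  with w have "recent H v \<subset> recent H w"
    by (auto simp: recent_def)
  then have "rank H v < rank H w"
    unfolding rank_eq_card_recent by (intro psubset_card_mono) auto
  with assms(2) show False
    by simp
qed

definition mru_depth :: "'a list \<Rightarrow> 'a \<Rightarrow> nat" where
  "mru_depth H v = nat \<lfloor>log 2 (real (rank H v))\<rfloor>"

lemma mru_tree_item_depth: "mru_tree V H T \<Longrightarrow> v \<in> V \<Longrightarrow> item_depth T v = mru_depth H v"
  by (auto simp: mru_tree_def mru_depth_def)

lemma le_mru_depth:
  assumes "2 ^ k \<le> rank H v"
  shows "k \<le> mru_depth H v"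
proof -
  have "(2::real) ^ k \<le> real (rank H v)"
    using assms by (metis of_nat_le_iff of_nat_numeral of_nat_power)
  then have "real k \<le> log 2 (real (rank H v))"
    by (simp add: le_log_iff rank_pos powr_realpow)
  then have "int k \<le> \<lfloor>log 2 (real (rank H v))\<rfloor>"
    by (simp add: le_floor_iff)
  then show ?thesis
    by (simp add: mru_depth_def le_nat_iff)
qed

lemma mru_depth_mono: "rank H v \<le> rank H' w \<Longrightarrow> mru_depth H v \<le> mru_depth H' w"
  unfolding mru_depth_def by (intro nat_mono floor_mono log_mono) (auto simp: rank_pos)

subsection \<open>The item exchanged with the requested one\<close>

text \<open>This makes the \<open>ARG_MAX\<close> range over a nonempty set. At depth 0 the witness
  is \<open>u\<close>; otherwise half the depth is a full level.\<close>

lemma item_at_half_depth: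
  assumes "finite V" and "is_placement V T" and "u \<in> V"
  shows "\<exists>w\<in>V. item_depth T w = item_depth T u div 2"
proof (cases "item_depth T u = 0")
  case True
  with assms(3) show ?thesis by auto
next
  case False
  then have "2 ^ (item_depth T u div 2) \<le> card {w \<in> V. item_depth T w = item_depth T u div 2}"
    using assms by (intro card_full_level) auto
  then have "{w \<in> V. item_depth T w = item_depth T u div 2} \<noteq> {}"
    by (metis card.empty not_le zero_less_numeral zero_less_power)
  then show ?thesis by auto
qed

lemma highest_rank_item:
  assumes "w \<in> V" and "item_depth T w = k"
  shows "highest_rank_item V H T k \<in> V"
    and "item_depth T (highest_rank_item V H T k) = k"
    and "rank H w \<le> rank H (highest_rank_item V H T k)"
proof -
  let ?P = "\<lambda>v. v \<in> V \<and> item_depth T v = k"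
  let ?v = "highest_rank_item V H T k"
  \<comment> \<open>A maximum over \<open>nat\<close> needs a strict upper bound on the measure; the
    length of the history supplies one.\<close>
  have bd: "\<forall>y. ?P y \<longrightarrow> rank H y < Suc (Suc (length H))"
    by (simp add: rank_le less_Suc_eq_le)
  have "?P ?v \<and> (\<forall>y. ?P y \<longrightarrow> rank H y \<le> rank H ?v)"
    unfolding highest_rank_item_def using assms
    by (intro arg_max_nat_lemma[OF _ bd]) auto
  with assms show "?v \<in> V" "item_depth T ?v = k" "rank H w \<le> rank H ?v"
    by auto
qed

text \<open>By maximality, the window of \<open>v\<close> already holds the whole level
  \<open>k\<close>. The request adds \<open>u\<close>, which lies deeper, and this extra item makes
  the inequality strict.\<close>

lemma rank_highest_rank_item:
  assumes "finite V" and "set H = V" and "is_placement V T" and "u \<in> V"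
    and "k < item_depth T u" and v: "v = highest_rank_item V H T k"
  shows "2 ^ k < rank (H @ [u]) v"
proof -
  let ?W = "{w \<in> V. item_depth T w = k}"
  have W: "2 ^ k \<le> card ?W"
    using assms by (intro card_full_level)
  then have "?W \<noteq> {}"
    by (metis card.empty not_le zero_less_numeral zero_less_power)
  then have v': "v \<in> V" "item_depth T v = k"
    unfolding v using highest_rank_item(1,2)[of _ V T k H] by auto
  have "?W \<subseteq> recent H v"
    unfolding v using v' assms(2) highest_rank_item(3)[of _ V T k H]
    by (auto simp: v intro!: in_recent_if_rank_le)
  moreover have "v \<noteq> u"
    using v' assms(5) by auto
  ultimately have sub: "insert u ?W \<subseteq> recent (H @ [u]) v"
    by (auto simp: recent_snoc)
  have "2 ^ k < card (insert u ?W)"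
    using W assms(1,5) by auto
  also have "\<dots> \<le> rank (H @ [u]) v"
    unfolding rank_eq_card_recent using sub by (intro card_mono) auto
  finally show ?thesis .
qed

lemma is_placement_move_half_step:
  assumes "finite V" and "is_placement V T" and "u \<in> V"
  shows "is_placement V (move_half_step V H T u)"
proof -
  define v where "v = highest_rank_item V H T (item_depth T u div 2)"
  have v: "v \<in> V"
    using item_at_half_depth[OF assms] highest_rank_item(1) unfolding v_def by metis
  \<comment> \<open>This also covers \<open>u = v\<close>, where both sides are
    \<open>T\<close>.\<close>
  have "move_half_step V H T u = T \<circ> transpose u v"
    by (auto simp: move_half_step_def v_def[symmetric] Let_def transpose_def fun_eq_iff)
  moreover have "bij_betw (transpose u v) V V"
    using v assms(3) by (simp add: bij_betw_transpose_iff)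
  ultimately show ?thesis
    using assms(2) unfolding is_placement_def by (metis bij_betw_trans)
qed

subsection \<open>The potential\<close>

text \<open>In closed form this is \<open>2 * d\<close> minus the number of ones in the binary
  expansion of \<open>d\<close>.\<close>

fun halving_sum :: "nat \<Rightarrow> nat" where
  "halving_sum d = (if d = 0 then 0 else d + halving_sum (d div 2))"

declare halving_sum.simps [simp del]

lemma halving_sum_0 [simp]: "halving_sum 0 = 0"
  by (simp add: halving_sum.simps)

lemma halving_sum_rec: "halving_sum d = d + halving_sum (d div 2)"
  by (cases "d = 0") (simp_all add: halving_sum.simps[of d])

lemma halving_sum_less: "0 < d \<Longrightarrow> halving_sum d < 2 * d"
proof (induction d rule: halving_sum.induct)
  case (1 d)
  then show ?case
    by (cases "d div 2 = 0") (subst halving_sum_rec, fastforce)+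
qed

text \<open>The factor 4 originates here. With \<open>k = d div 2 > 0\<close>, the sum is at most
  \<open>(2 * k + 1) + (2 * k - 1)\<close>, using the strict bound for \<open>k\<close>. The
  \<open>max\<close> handles \<open>d = 1\<close>, where \<open>k = 0\<close> but the sum is
  1.\<close>

lemma halving_sum_le: "halving_sum d \<le> 4 * max 1 (d div 2)"
proof (cases "d div 2 = 0")
  case True
  then show ?thesis
    by (subst halving_sum_rec) auto
next
  case False
  then have "halving_sum (d div 2) < 2 * (d div 2)"
    by (intro halving_sum_less) simp
  then show ?thesis
    using False by (subst halving_sum_rec) auto
qed

text \<open>Truncation keeps the potential nonnegative and prevents an item close to the root from
  offsetting the excess of another.\<close>

definition excess :: "'a list \<Rightarrow> 'a placement \<Rightarrow> 'a \<Rightarrow> nat" where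
  "excess H T v = halving_sum (item_depth T v) - 4 * mru_depth H v"

lemma excess_mru_tree:
  assumes "mru_tree V H T" and "v \<in> V"
  shows "excess H T v = 0"
  using mru_tree_item_depth[OF assms] halving_sum_less[of "item_depth T v"]
  by (cases "item_depth T v = 0") (auto simp: excess_def)

lemma excess_move_half_step_le:
  assumes "finite V" and "set H = V" and "is_placement V T" and "u \<in> V" and "w \<noteq> u"
  shows "excess (H @ [u]) (move_half_step V H T u) w \<le> excess H T w"
proof -
  define d where "d = item_depth T u"
  define v where "v = highest_rank_item V H T (d div 2)"
  have step: "move_half_step V H T u = T(u := T v, v := T u)"
    by (simp add: move_half_step_def v_def d_def Let_def)
  show ?thesis
  proof (cases "w = v")
    case True
    then have "item_depth (move_half_step V H T u) w = d"
      by (simp add: step d_def item_depth_def)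
    moreover have "halving_sum d \<le> 4 * mru_depth (H @ [u]) v"
    proof (cases "d = 0")
      case False
      then have less: "2 ^ (d div 2) < rank (H @ [u]) v"
        using assms by (intro rank_highest_rank_item) (auto simp: v_def d_def)
      \<comment> \<open>For \<open>d = 1\<close> strictness is essential: a rank above 1 is at least
        2, which gives MRU depth at least 1.\<close>
      have "2 ^ max 1 (d div 2) \<le> rank (H @ [u]) v"
        using less by (cases "d div 2 = 0") (auto simp: max_def)
      then have "max 1 (d div 2) \<le> mru_depth (H @ [u]) v"
        by (rule le_mru_depth)
      then show ?thesis
        using halving_sum_le[of d] by linarith
    qed simp
    ultimately show ?thesis
      by (simp add: excess_def True)
  next
    case False
    then have "item_depth (move_half_step V H T u) w = item_depth T w"
      using assms(5) by (simp add: step item_depth_def)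
    then show ?thesis
      using mru_depth_mono[OF rank_le_rank_snoc[OF assms(5), of H]]
      by (simp add: excess_def diff_le_mono2)
  qed
qed

text \<open>The new excess is at most \<open>halving_sum (d div 2)\<close> under any history, and
  adding \<open>d\<close> gives \<open>halving_sum d\<close>, which the right-hand side dominates
  despite truncation.\<close>

lemma excess_requested_move_half_step:
  assumes "finite V" and "is_placement V T" and "u \<in> V"
  shows "item_depth T u + excess H' (move_half_step V H T u) u
    \<le> excess H T u + 4 * mru_depth H u"
proof -
  define d where "d = item_depth T u"
  define v where "v = highest_rank_item V H T (d div 2)"
  have step: "move_half_step V H T u = T(u := T v, v := T u)"
    by (simp add: move_half_step_def v_def d_def Let_def)
  have "item_depth T v = d div 2"
    using item_at_half_depth[OF assms] highest_rank_item(2) unfolding v_def d_def by metis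
  then have "item_depth (move_half_step V H T u) u = d div 2"
    by (auto simp: step item_depth_def)
  then show ?thesis
    using halving_sum_rec[of d] by (simp add: excess_def d_def[symmetric])
qed

lemma amortized_move_half_step:
  assumes "finite V" and "set H = V" and "is_placement V T" and "u \<in> V"
  shows "item_depth T u + (\<Sum>w\<in>V. excess (H @ [u]) (move_half_step V H T u) w)
    \<le> (\<Sum>w\<in>V. excess H T w) + 4 * mru_depth H u"
proof -
  have "(\<Sum>w\<in>V - {u}. excess (H @ [u]) (move_half_step V H T u) w)
      \<le> (\<Sum>w\<in>V - {u}. excess H T w)"
    using assms by (intro sum_mono excess_move_half_step_le) auto
  then show ?thesis
    using excess_requested_move_half_step[OF assms(1,3,4), of "H @ [u]" H]
    by (simp add: sum.remove[OF assms(1,4)])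
qed

lemma access_cost_Cons:
  "access_cost A (u # \<sigma>) = item_depth (A []) u + access_cost (\<lambda>\<tau>. A (u # \<tau>)) \<sigma>"
  by (simp add: access_cost_def sum.lessThan_Suc_shift del: sum.lessThan_Suc)

text \<open>Peeling off the first request turns \<open>A\<close> into its continuation after
  \<open>u\<close>, which is an MRU algorithm for the history \<open>H @ [u]\<close>; hence
  \<open>H\<close>, \<open>T\<close> and \<open>A\<close> all vary in the induction.\<close>

lemma access_cost_move_half_le:
  assumes "finite V"
  shows "set H = V \<Longrightarrow> is_placement V T \<Longrightarrow> set \<sigma> \<subseteq> V \<Longrightarrow> mru_algorithm V H A \<Longrightarrow>
    access_cost (move_half V H T) \<sigma> \<le> (\<Sum>w\<in>V. excess H T w) + 4 * access_cost A \<sigma>"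
proof (induction \<sigma> arbitrary: H T A)
  case Nil
  show ?case
    by (simp add: access_cost_def)
next
  case (Cons u \<sigma>)
  let ?T = "move_half_step V H T u"
  have u: "u \<in> V"
    using Cons.prems by simp
  have "mru_tree V H (A [])"
    using Cons.prems(4) unfolding mru_algorithm_def by (metis append_Nil2 empty_set empty_subsetI)
  then have A: "item_depth (A []) u = mru_depth H u"
    using u by (rule mru_tree_item_depth)
  have "mru_algorithm V (H @ [u]) (\<lambda>\<tau>. A (u # \<tau>))"
    using Cons.prems(4) u by (simp add: mru_algorithm_def)
  then have "access_cost (move_half V (H @ [u]) ?T) \<sigma>
      \<le> (\<Sum>w\<in>V. excess (H @ [u]) ?T w) + 4 * access_cost (\<lambda>\<tau>. A (u # \<tau>)) \<sigma>"
    using Cons.prems u assms by (intro Cons.IH is_placement_move_half_step) auto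
  then show ?case
    using amortized_move_half_step[OF assms Cons.prems(1,2) u] A
    by (simp add: access_cost_Cons)
qed

theorem theorem5:
  fixes V :: "'a set" and h \<sigma> :: "'a list"
    and T0 :: "'a placement" and A :: "'a list \<Rightarrow> 'a placement"
  assumes "finite V" and "V \<noteq> {}"
    and "set h = V"
    and "mru_tree V h T0"
    and "mru_algorithm V h A"
    and "set \<sigma> \<subseteq> V"
  shows "access_cost (move_half V h T0) \<sigma> \<le> 4 * access_cost A \<sigma>"
proof -
  have "is_placement V T0"
    using assms(4) by (simp add: mru_tree_def)
  then show ?thesis
    using access_cost_move_half_le[OF assms(1,3) _ assms(6,5), of T0] excess_mru_tree[OF assms(4)]
    by simp
qed

end
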